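(* Let $\tilde u$ satisfy Condition $Z$-SINH3$(a_-,a_+;\gamma)$ (stated in the context) with exponent $m_{\tilde u}$, and let $n>m_{\tilde u}$. Then: (a) for any $\omega_\ell\in(-\gamma/2,\gamma/2)$ there exist $b_\ell>0$ and $\sigma_\ell\in(a_-+b_\ell\sin(\omega_\ell),\,a_++b_\ell\sin(\omega_\ell))$ such that $$u_n=\frac1{2\pi i}\int_{\mathcal L_{L;\sigma_\ell,b_\ell,\omega_\ell}}\big(\tilde u(z)+(-1)^n\tilde u(-z)\big)z^{-n-1}\,dz;$$ (b) there exists $d_\ell>0$ such that $\chi_{L;\sigma_\ell,b_\ell,\omega_\ell}(S_{(-d_\ell,d_\ell)})\subset\mathcal U^{\mathrm{sym}}(a_-,a_+,\gamma)$.
   Context: Setting: $u=(u_k)_{k\in\mathbb Z}\in\ell_1(\mathbb Z)$, $\tilde u(z)=\sum_{k\in\mathbb Z}u_kz^k$ is its (two-sided) $Z$-transform, a continuous function on the unit circle $\mathbb T$ (one-sided sequences are the case $u_k=0$ for $k<0$), so that $u_n=\frac1{2\pi i}\int_{\mathbb T}\tilde u(z)z^{-n-1}dz$. The integer $n$ is nonnegative. The analytic continuation of $\tilde u$ is denoted by the same symbol. Sinh-deformation: for $\sigma_\ell\in\mathbb R$, $b_\ell>0$, $\omega_\ell\in(-\pi/2,\pi/2)$, set $\chi_{L;\sigma_\ell,b_\ell,\omega_\ell}(y)=\sigma_\ell+ib_\ell\sinh(i\omega_\ell+y)$ and $\mathcal L_{L;\sigma_\ell,b_\ell,\omega_\ell}=\chi_{L;\sigma_\ell,b_\ell,\omega_\ell}(\mathbb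 R)$, oriented by increasing $y\in\mathbb R$. For $d>0$, $S_{(-d,d)}=\{y\in\mathbb C : |\mathrm{Im}\,y|<d\}$. Domains: for $\gamma\in(0,\pi)$, $\mathcal C_\gamma=\{\rho e^{i\varphi}:|\varphi|<\gamma,\ \rho>0\}$, and $$\mathcal U^{\mathrm{sym}}(a_-,a_+,\gamma)=\big((-a_+,a_+)+i(\mathcal C_\gamma\cup\{0\}\cup(-\mathcal C_\gamma))\big)\setminus\{z:|z|\le a_-\},$$ where $+$ denotes the Minkowski sum. Condition $Z$-SINH3$(a_-,a_+;\gamma)$: $0<\gamma\le\pi/2$ and $0\le a_-<1\le a_+$ are such that (i) $\tilde u$ admits analytic continuation to $\mathcal U^{\mathrm{sym}}(a_-,a_+,\gamma)$; (ii) for any $a_-<r_-<r_+<a_+$ and $\gamma'\in(0,\gamma)$, $$|\tilde u(z)|\le C_{\tilde u}(r_-,r_+;\gamma')(1+|z|)^{m_{\tilde u}},\quad z\in\mathcal U^{\mathrm{sym}}(r_-,r_+,\gamma'),$$ where $m_{\tilde u}$ depends only on $\tilde u$, and the constant $C_{\tilde u}(r_-,r_+;\gamma')$ depends on $(r_-,r_+,\gamma')$.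
   Formalization: If a_+ = 1, the continuation is also assumed to attain the values of the Z-transform at 1 and -1 continuously from within the closed unit disc; without this the formula fails, e.g. for (1-z)^4 exp((1+z)/(1-z)). For a_+ > 1 or one-sided sequences this is automatic. *)

theory Defs
  imports "HOL-Analysis.Analysis"
begin

definition ell1 :: "(int \<Rightarrow> complex) \<Rightarrow> bool" where
  "ell1 u \<longleftrightarrow> (\<lambda>k. norm (u k)) summable_on UNIV"

definition ztransform :: "(int \<Rightarrow> complex) \<Rightarrow> complex \<Rightarrow> complex" where
  "ztransform u z = (\<Sum>\<^sub>\<infinity>k. u k * z powi k)"

definition cone :: "real \<Rightarrow> complex set" where
  "cone \<gamma> = {of_real \<rho> * exp (\<i> * of_real \<phi>) | \<rho> \<phi>. \<bar>\<phi>\<bar> < \<gamma> \<and> \<rho> > 0}"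

definition Usym :: "real \<Rightarrow> real \<Rightarrow> real \<Rightarrow> complex set" where
  "Usym am ap \<gamma> =
     {of_real x + \<i> * w | x w. x \<in> {-ap<..<ap} \<and> w \<in> cone \<gamma> \<union> {0} \<union> uminus ` cone \<gamma>}
       - {z. norm z \<le> am}"

text \<open>
  \<open>F\<close> is an analytic continuation of the Z-transform from the unit circle to \<open>Usym am ap \<gamma>\<close>;
  its values outside \<open>Usym am ap \<gamma> \<union> sphere 0 1\<close> are irrelevant.  If \<open>ap > 1\<close>, the circle lies
  in the open set \<open>Usym am ap \<gamma>\<close> and the last clause follows from the first.  If \<open>ap = 1\<close>, the
  points \<open>1\<close> and \<open>-1\<close> are boundary points, and the last clause says that \<open>F\<close> attains the
  boundary values there continuously from within the closed unit disc.  This is automatic for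
  one-sided sequences.  For two-sided ones, agreement on the rest of the circle does not
  imply it: \<open>(1 - z)^4 * exp ((1 + z) / (1 - z))\<close> has absolutely summable Fourier coefficients on
  the circle, but its Fourier coefficients are not its Taylor coefficients at \<open>0\<close>.
\<close>
definition continues_ztransform ::
    "(int \<Rightarrow> complex) \<Rightarrow> (complex \<Rightarrow> complex) \<Rightarrow> real \<Rightarrow> real \<Rightarrow> real \<Rightarrow> bool" where
  "continues_ztransform u F am ap \<gamma> \<longleftrightarrow>
     F holomorphic_on Usym am ap \<gamma> \<and>
     (\<forall>z\<in>sphere 0 1. F z = ztransform u z) \<and>
     continuous_on ((Usym am ap \<gamma> \<union> sphere 0 1) \<inter> cball 0 1) F"

text \<open>
  The exponent \<open>m\<close> is common to all triples \<open>(rm, rp, \<gamma>')\<close>, the constant \<open>C\<close> is not.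
\<close>
definition Z_SINH3 ::
    "(int \<Rightarrow> complex) \<Rightarrow> (complex \<Rightarrow> complex) \<Rightarrow> real \<Rightarrow> real \<Rightarrow> real \<Rightarrow> real \<Rightarrow> bool" where
  "Z_SINH3 u F m am ap \<gamma> \<longleftrightarrow>
     0 < \<gamma> \<and> \<gamma> \<le> pi / 2 \<and> 0 \<le> am \<and> am < 1 \<and> 1 \<le> ap \<and>
     continues_ztransform u F am ap \<gamma> \<and>
     (\<forall>rm rp \<gamma>'. am < rm \<and> rm < rp \<and> rp < ap \<and> 0 < \<gamma>' \<and> \<gamma>' < \<gamma> \<longrightarrow>
        (\<exists>C. \<forall>z\<in>Usym rm rp \<gamma>'. norm (F z) \<le> C * (1 + norm z) powr m))"

definition chiL :: "real \<Rightarrow> real \<Rightarrow> real \<Rightarrow> complex \<Rightarrow> complex" where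
  "chiL \<sigma> b \<omega> y = of_real \<sigma> + \<i> * of_real b * sinh (\<i> * of_real \<omega> + y)"

definition strip :: "real \<Rightarrow> complex set" where
  "strip d = {y. \<bar>Im y\<bar> < d}"

text \<open>
  Integrals along a curve parametrized by the whole real line (the library's contour integrals
  are over paths on \<open>{0..1}\<close>), oriented by increasing parameter and absolutely convergent.
\<close>
definition line_integrable :: "(real \<Rightarrow> complex) \<Rightarrow> (complex \<Rightarrow> complex) \<Rightarrow> bool" where
  "line_integrable c g \<longleftrightarrow> integrable lborel (\<lambda>y. g (c y) * vector_derivative c (at y))"

definition line_integral :: "(real \<Rightarrow> complex) \<Rightarrow> (complex \<Rightarrow> complex) \<Rightarrow> complex" where
  "line_integral c g = (LINT y|lborel. g (c y) * vector_derivative c (at y))"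

end

theory Submission
  imports Defs "HOL-Complex_Analysis.Complex_Analysis" "HOL-Real_Asymp.Real_Asymp"
begin

text \<open>
Write \<open>G z = (F z + (-1) ^ n * F (- z)) * z powi (- n - 1)\<close> for the integrand.  It is an
odd function.  In the coordinate \<open>w\<close> with \<open>z = exp w\<close>, the form \<open>G z dz\<close> becomes \<open>H w dw\<close> with
\<open>H w = G (exp w) * exp w\<close>, and since \<open>G\<close> is odd, \<open>H\<close> has period \<open>\<i> * pi\<close>, half the period of
\<open>exp\<close>.

The preimage \<open>D\<close> of the domain \<open>Usym am ap \<gamma>\<close> under \<open>exp\<close> is contractible: moving \<open>z\<close> radially
to a circle of some radius between \<open>am\<close> and \<open>1\<close> stays in the domain, and in the coordinate \<open>w\<close>
this is a horizontal contraction of \<open>D\<close> onto a vertical line (\<open>contractible_exp_vimage_Usym\<close>).  Hence \<open>H\<close>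
has a primitive \<open>\<Phi>\<close> on all of \<open>D\<close>, and \<open>\<Phi> (w + \<i> * pi) - \<Phi> w\<close> is a constant \<open>c\<close>
(\<open>log_kernel_primitive\<close>).  This \<open>c\<close> is the integral of \<open>H\<close> over a vertical segment of length
\<open>pi\<close>, that is, of \<open>G\<close> over the right half of a circle.  Letting the radius tend to \<open>1\<close> and integrating
the series of the Z-transform term by term, only the term of index \<open>n\<close> survives: the summand of
\<open>F (- z)\<close> cancels the indices of the wrong parity, and the remaining exponentials have mean zero
over the half circle.  So \<open>c = 2 * pi * \<i> * u n\<close> (\<open>log_kernel_period_eq_coefficient\<close>).

The curve \<open>chiL \<sigma> b \<omega>\<close> meets the real axis only at \<open>x\<^sub>0 = \<sigma> - b * sin \<omega>\<close>.  For \<open>x\<^sub>0\<close> between \<open>am\<close>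
and \<open>1\<close> and \<open>b\<close> large it stays at distance at least \<open>x\<^sub>0\<close> from the origin and inside the domain
(\<open>norm_chiL_ge\<close>, \<open>chiL_mem_Usym\<close>).  Its logarithm is a path in \<open>D\<close>, so the integral of \<open>G\<close> over
\<open>{-y..y}\<close> is a difference of values of \<open>\<Phi>\<close>.  The curve is symmetric under conjugation, so its
end points have logarithms \<open>s + \<i> * (pi/2 + \<phi>)\<close> and \<open>s - \<i> * (pi/2 + \<phi>)\<close>.  Moving the second one
up by \<open>\<i> * pi\<close> gives \<open>s + \<i> * (pi/2 - \<phi>)\<close>, at the cost of \<open>c\<close>.  What is left is the integral of
\<open>G\<close> over a circular arc of radius \<open>exp s\<close> around the imaginary axis, which is
\<open>O(exp (s * (m - n)))\<close> and vanishes in the limit because \<open>m < n\<close> (\<open>norm_arc_difference_le\<close>).  The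
same bound on \<open>G\<close> makes the integral over the whole curve absolutely convergent.

Shifting the parameter of the curve by \<open>\<i> * t\<close> replaces \<open>\<omega>\<close> by \<open>\<omega> + t\<close>, and all conditions on
\<open>\<omega>\<close> are open; this gives the strip (\<open>strip_subset_Usym\<close>).
\<close>

section \<open>The double-cone domain\<close>

text \<open>
The difference of the two sides is \<open>sin (\<gamma> - \<bar>\<phi>\<bar>)\<close>.  In this form the comparison of the angles
\<open>\<phi>\<close> and \<open>\<gamma>\<close> avoids \<open>tan \<gamma>\<close>, which has no useful value at \<open>\<gamma> = pi / 2\<close>.
\<close>
lemma abs_sin_cos_less:
  fixes \<phi> \<gamma> :: real
  assumes "\<bar>\<phi>\<bar> < \<gamma>" "\<gamma> \<le> pi / 2"
  shows "\<bar>sin \<phi>\<bar> * cos \<gamma> < cos \<phi> * sin \<gamma>"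
proof -
  have "\<bar>sin \<phi>\<bar> = sin \<bar>\<phi>\<bar>"
    using assms sin_ge_zero[of "\<bar>\<phi>\<bar>"] by (auto simp: abs_if)
  moreover have "sin (\<gamma> - \<bar>\<phi>\<bar>) > 0"
    using assms by (intro sin_gt_zero) auto
  moreover have "cos \<bar>\<phi>\<bar> = cos \<phi>"
    by (auto simp: abs_if)
  ultimately show ?thesis
    by (simp add: sin_diff algebra_simps)
qed

lemma mem_cone_iff:
  assumes "0 < \<gamma>" "\<gamma> \<le> pi / 2"
  shows "w \<in> cone \<gamma> \<longleftrightarrow> \<bar>Im w\<bar> * cos \<gamma> < Re w * sin \<gamma>"
proof
  assume "w \<in> cone \<gamma>"
  then obtain \<rho> \<phi> where w: "w = of_real \<rho> * exp (\<i> * of_real \<phi>)" "\<bar>\<phi>\<bar> < \<gamma>" "\<rho> > 0"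
    unfolding cone_def by blast
  have "Re w = \<rho> * cos \<phi>" "Im w = \<rho> * sin \<phi>"
    unfolding w(1) exp_eq_polar by auto
  with abs_sin_cos_less[OF w(2) assms(2)] w(3)
  show "\<bar>Im w\<bar> * cos \<gamma> < Re w * sin \<gamma>"
    by (simp add: abs_mult)
next
  assume less: "\<bar>Im w\<bar> * cos \<gamma> < Re w * sin \<gamma>"
  have sin: "sin \<gamma> > 0" and cos: "cos \<gamma> \<ge> 0"
    using assms by (auto intro: sin_gt_zero cos_ge_zero)
  have Re: "Re w > 0"
    using less sin cos by (smt (verit) mult_nonneg_nonneg zero_less_mult_pos2)
  then have "w \<noteq> 0"
    by auto
  \<comment> \<open>As \<open>\<bar>Arg w\<bar> < pi / 2\<close>, the sign of \<open>sin (\<gamma> - \<bar>Arg w\<bar>)\<close> decides which angle is larger.\<close>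
  define \<phi> where "\<phi> = Arg w"
  have w: "w = of_real (norm w) * exp (\<i> * of_real \<phi>)"
    unfolding \<phi>_def using \<open>w \<noteq> 0\<close> by (rule Arg_eq)
  have ReIm: "Re w = norm w * cos \<phi>" "Im w = norm w * sin \<phi>"
    by (subst w, simp add: exp_eq_polar)+
  have \<phi>: "\<bar>\<phi>\<bar> < pi / 2"
    using Re \<open>w \<noteq> 0\<close> Re_Ln_pos_lt[of w] by (simp add: \<phi>_def Arg_def)
  have "norm w * (\<bar>sin \<phi>\<bar> * cos \<gamma>) < norm w * (cos \<phi> * sin \<gamma>)"
    using less unfolding ReIm by (simp add: abs_mult mult_ac)
  then have "\<bar>sin \<phi>\<bar> * cos \<gamma> < cos \<phi> * sin \<gamma>"
    using \<open>w \<noteq> 0\<close> by simp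
  moreover have "cos \<bar>\<phi>\<bar> = cos \<phi>" "sin \<bar>\<phi>\<bar> = \<bar>sin \<phi>\<bar>"
    using \<phi> sin_ge_zero[of "\<bar>\<phi>\<bar>"] by (auto simp: abs_if)
  ultimately have "sin (\<gamma> - \<bar>\<phi>\<bar>) > 0"
    by (simp add: sin_diff mult_ac)
  moreover have "sin (\<gamma> - \<bar>\<phi>\<bar>) \<le> 0" if "\<gamma> \<le> \<bar>\<phi>\<bar>"
    using that \<phi> assms sin_ge_zero[of "\<bar>\<phi>\<bar> - \<gamma>"] sin_minus[of "\<bar>\<phi>\<bar> - \<gamma>"] by simp
  ultimately have "\<bar>\<phi>\<bar> < \<gamma>"
    by force
  then show "w \<in> cone \<gamma>"
    unfolding cone_def using w \<open>w \<noteq> 0\<close> by (smt (verit) mem_Collect_eq zero_less_norm_iff)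
qed

text \<open>
The point \<open>x\<close> is the apex of a vertical double cone that contains \<open>z\<close>.  The apex itself, where the
cone inequality fails, is covered by the first alternative; allowing the whole strip
\<open>\<bar>Re z\<bar> < ap\<close> there is harmless, since each of its points outside the real axis lies on the axis of such a cone.
\<close>
lemma mem_Usym_iff:
  assumes "0 < \<gamma>" "\<gamma> \<le> pi / 2"
  shows "z \<in> Usym am ap \<gamma> \<longleftrightarrow> am < norm z \<and>
           (\<bar>Re z\<bar> < ap \<or> (\<exists>x. \<bar>x\<bar> < ap \<and> \<bar>Re z - x\<bar> * cos \<gamma> < \<bar>Im z\<bar> * sin \<gamma>))"
    (is "_ \<longleftrightarrow> _ \<and> ?P")
proof -
  have sin: "sin \<gamma> > 0"
    using assms by (auto intro: sin_gt_zero)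
  have dc: "w \<in> cone \<gamma> \<union> uminus ` cone \<gamma> \<longleftrightarrow> \<bar>Im w\<bar> * cos \<gamma> < \<bar>Re w\<bar> * sin \<gamma>" for w
  proof -
    have "w \<in> uminus ` cone \<gamma> \<longleftrightarrow> - w \<in> cone \<gamma>"
      by (metis (no_types, lifting) image_iff minus_minus)
    moreover have "\<bar>Re w\<bar> * sin \<gamma> = \<bar>Re w * sin \<gamma>\<bar>"
      using sin by (simp add: abs_mult)
    ultimately show ?thesis
      by (auto simp: mem_cone_iff[OF assms])
  qed
  have "(\<exists>x w. z = of_real x + \<i> * w \<and> x \<in> {-ap<..<ap} \<and> w \<in> cone \<gamma> \<union> {0} \<union> uminus ` cone \<gamma>) \<longleftrightarrow> ?P"
    (is "?L \<longleftrightarrow> _")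
  proof
    assume ?L
    then obtain x w where z: "z = of_real x + \<i> * w" and x: "x \<in> {-ap<..<ap}"
      and w: "w = 0 \<or> w \<in> cone \<gamma> \<union> uminus ` cone \<gamma>"
      by blast
    from x have "\<bar>x\<bar> < ap"
      by auto
    then show ?P
      using w unfolding dc z by auto
  next
    assume ?P
    then consider "\<bar>Re z\<bar> < ap" "Im z = 0" | x where "\<bar>x\<bar> < ap" "\<bar>Re z - x\<bar> * cos \<gamma> < \<bar>Im z\<bar> * sin \<gamma>"
      using sin by (cases "Im z = 0") force+
    then show ?L
    proof cases
      case 1
      then have "z = of_real (Re z) + \<i> * 0"
        by (simp add: complex_eq_iff)
      then show ?thesis
        using 1 by (intro exI[of _ "Re z"] exI[of _ 0]) (auto simp: abs_less_iff)
    next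
      case (2 x)
      define w where "w = - \<i> * (z - of_real x)"
      have "z = of_real x + \<i> * w"
        by (simp add: w_def complex_eq_iff)
      moreover have "w \<in> cone \<gamma> \<union> uminus ` cone \<gamma>"
        unfolding dc using 2(2) by (simp add: w_def abs_minus_commute)
      ultimately show ?thesis
        using 2(1) by (intro exI[of _ x] exI[of _ w]) (auto simp: abs_less_iff)
    qed
  qed
  then show ?thesis
    unfolding Usym_def by auto
qed

lemma open_Usym:
  assumes "0 < \<gamma>" "\<gamma> \<le> pi / 2"
  shows "open (Usym am ap \<gamma>)"
proof -
  have "Usym am ap \<gamma> = {z. am < norm z} \<inter> ({z. \<bar>Re z\<bar> < ap} \<union>
          (\<Union>x\<in>{x. \<bar>x\<bar> < ap}. {z. \<bar>Re z - x\<bar> * cos \<gamma> < \<bar>Im z\<bar> * sin \<gamma>}))"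
    using mem_Usym_iff[OF assms] by auto
  also have "open \<dots>"
    by (intro open_Int open_Un open_UN ballI open_Collect_less continuous_intros)
  finally show ?thesis .
qed

lemma Usym_mono:
  assumes "am \<le> am'" "ap' \<le> ap" "\<gamma>' \<le> \<gamma>"
  shows "Usym am' ap' \<gamma>' \<subseteq> Usym am ap \<gamma>"
proof -
  have "cone \<gamma>' \<subseteq> cone \<gamma>"
    using assms(3) unfolding cone_def by force
  then have "cone \<gamma>' \<union> {0} \<union> uminus ` cone \<gamma>' \<subseteq> cone \<gamma> \<union> {0} \<union> uminus ` cone \<gamma>"
    by blast
  moreover have "{-ap'<..<ap'} \<subseteq> {-ap<..<ap}" "{z::complex. norm z \<le> am} \<subseteq> {z. norm z \<le> am'}"
    using assms by auto
  ultimately show ?thesis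
    unfolding Usym_def by blast
qed

lemma uminus_mem_Usym_iff:
  assumes "0 < \<gamma>" "\<gamma> \<le> pi / 2"
  shows "- z \<in> Usym am ap \<gamma> \<longleftrightarrow> z \<in> Usym am ap \<gamma>"
proof -
  have "- z \<in> Usym am ap \<gamma>" if "z \<in> Usym am ap \<gamma>" for z
  proof -
    have "\<exists>x'. \<bar>x'\<bar> < ap \<and> \<bar>- Re z - x'\<bar> * cos \<gamma> < \<bar>Im z\<bar> * sin \<gamma>"
      if "\<bar>x\<bar> < ap" "\<bar>Re z - x\<bar> * cos \<gamma> < \<bar>Im z\<bar> * sin \<gamma>" for x
      using that by (intro exI[of _ "-x"]) (simp add: abs_minus_commute)
    with that show ?thesis
      unfolding mem_Usym_iff[OF assms] by auto
  qed
  from this[of z] this[of "- z"] show ?thesis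
    by auto
qed

text \<open>
Shrinking moves the apex of the double cone towards \<open>0\<close> and preserves its opening angle.
\<close>
lemma scaleR_mem_Usym:
  assumes "0 < \<gamma>" "\<gamma> \<le> pi / 2" and "z \<in> Usym am ap \<gamma>"
    and "0 < t" "t \<le> 1" "am < t * norm z"
  shows "t *\<^sub>R z \<in> Usym am ap \<gamma>"
proof -
  have le: "t * \<bar>x\<bar> < ap" if "\<bar>x\<bar> < ap" for x
    using that assms(4,5) by (smt (verit) mult_left_le_one_le)
  have "\<exists>x'. \<bar>x'\<bar> < ap \<and> \<bar>t * Re z - x'\<bar> * cos \<gamma> < \<bar>t * Im z\<bar> * sin \<gamma>"
    if "\<bar>x\<bar> < ap" "\<bar>Re z - x\<bar> * cos \<gamma> < \<bar>Im z\<bar> * sin \<gamma>" for x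
  proof (intro exI conjI)
    show "\<bar>t * x\<bar> < ap"
      using le[OF that(1)] assms(4) by (simp add: abs_mult)
    have "\<bar>t * Re z - t * x\<bar> = t * \<bar>Re z - x\<bar>"
      using assms(4) by (simp add: abs_mult flip: right_diff_distrib)
    then show "\<bar>t * Re z - t * x\<bar> * cos \<gamma> < \<bar>t * Im z\<bar> * sin \<gamma>"
      using mult_strict_left_mono[OF that(2) assms(4)] assms(4) by (simp add: abs_mult mult.assoc)
  qed
  then show ?thesis
    using assms(3,4,6) le unfolding mem_Usym_iff[OF assms(1,2)] by (auto simp: abs_mult)
qed

lemma annulus_subset_Usym:
  assumes "0 < \<gamma>" "\<gamma> \<le> pi / 2" "am < norm z" "norm z < ap"
  shows "z \<in> Usym am ap \<gamma>"
  using assms abs_Re_le_cmod[of z] by (auto simp: mem_Usym_iff)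

lemma closed_annulus_subset_domain:
  assumes "0 < \<gamma>" "\<gamma> \<le> pi / 2" "1 \<le> ap" "am < norm z" "norm z \<le> 1"
  shows "z \<in> (Usym am ap \<gamma> \<union> sphere 0 1) \<inter> cball 0 1"
  using assms annulus_subset_Usym[of \<gamma> am z ap] by (cases "norm z = 1") auto

lemma open_exp_vimage_Usym:
  assumes "0 < \<gamma>" "\<gamma> \<le> pi / 2"
  shows "open (exp -` Usym am ap \<gamma> :: complex set)"
  by (intro open_vimage open_Usym assms continuous_intros)

text \<open>
In the coordinate \<open>w\<close>, scaling \<open>z\<close> is a horizontal translation.  Every point of the preimage can be
moved horizontally to the line \<open>Re w = s\<close>, where \<open>am < exp s < 1\<close>: from the right because the
domain is closed under shrinking, from the left because the annulus between \<open>am\<close> and \<open>ap\<close> belongs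
to the domain.  The line then contracts to a point.
\<close>
lemma contractible_exp_vimage_Usym:
  assumes "0 < \<gamma>" "\<gamma> \<le> pi / 2" "0 \<le> am" "am < 1" "1 \<le> ap"
  shows "contractible (exp -` Usym am ap \<gamma> :: complex set)" (is "contractible ?D")
proof -
  define s where "s = ln ((am + 1) / 2)"
  have s: "am < exp s" "exp s < 1"
    using assms unfolding s_def by (auto simp: field_simps)
  have line: "exp w \<in> Usym am ap \<gamma>" if "Re w = s" for w :: complex
    using that s less_le_trans[OF s(2) assms(5)] assms by (intro annulus_subset_Usym) auto
  define p where "p = (\<lambda>w::complex. Complex s (Im w))"
  have hor: "closed_segment w (p w) \<subseteq> ?D" if "w \<in> ?D" for w
  proof
    fix v assume "v \<in> closed_segment w (p w)"
    then obtain t where t: "0 \<le> t" "t \<le> 1" and v: "v = (1 - t) *\<^sub>R w + t *\<^sub>R p w"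
      by (auto simp: closed_segment_def)
    have Re: "Re v = Re w + t * (s - Re w)" and Im: "Im v = Im w"
      unfolding v p_def by (auto simp: algebra_simps)
    have w: "exp w \<in> Usym am ap \<gamma>"
      using that by simp
    then have am: "am < exp (Re w)"
      using mem_Usym_iff[OF assms(1,2)] by simp
    show "v \<in> ?D"
    proof (cases "Re w < s")
      case True
      have "Re w \<le> Re v" "Re v \<le> s"
        using True t mult_left_le_one_le[of "s - Re w" t] mult_nonneg_nonneg[of t "s - Re w"]
        unfolding Re by linarith+
      then have "am < exp (Re v)" "exp (Re v) < ap"
        using am s assms(5) by (smt (verit) exp_le_cancel_iff)+
      then show ?thesis
        using assms by (auto intro!: annulus_subset_Usym)
    next
      case False
      have le: "Re v \<le> Re w" and ge: "s \<le> Re v"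
        using False t mult_left_le_one_le[of "Re w - s" t] mult_nonneg_nonneg[of t "Re w - s"]
        unfolding Re by (simp_all add: right_diff_distrib)
      have "exp v = exp (Re v - Re w) *\<^sub>R exp w"
        using Im by (simp add: complex_eq_iff Re_exp Im_exp exp_diff)
      moreover have "exp (Re v - Re w) *\<^sub>R exp w \<in> Usym am ap \<gamma>"
        using w le ge s(1) assms
        by (intro scaleR_mem_Usym) (auto simp flip: exp_add intro: less_le_trans)
      ultimately show ?thesis
        by simp
    qed
  qed
  have "homotopic_with_canon (\<lambda>_. True) ?D ?D id p"
    unfolding p_def Complex_eq
    by (intro homotopic_with_linear continuous_intros) (use hor in \<open>auto simp: p_def Complex_eq\<close>)
  moreover have "homotopic_with_canon (\<lambda>_. True) ?D ?D p (\<lambda>_. of_real s)"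
  proof (rule homotopic_with_linear)
    show "continuous_on ?D p"
      unfolding p_def Complex_eq by (intro continuous_intros)
    show "closed_segment (p w) (of_real s) \<subseteq> ?D" for w
    proof
      fix v assume "v \<in> closed_segment (p w) (of_real s :: complex)"
      then obtain t where "v = (1 - t) *\<^sub>R p w + t *\<^sub>R of_real s"
        unfolding closed_segment_def by blast
      then have "Re v = s"
        by (simp add: p_def left_diff_distrib)
      then show "v \<in> ?D"
        using line by simp
    qed
  qed auto
  ultimately show ?thesis
    unfolding contractible_def using homotopic_with_trans by blast
qed

text \<open>
Such a point lies in the double cone with apex \<open>0\<close>.
\<close>
lemma exp_near_imaginary_axis_mem_Usym:
  assumes "0 < \<gamma>" "\<gamma> \<le> pi / 2" "0 < ap" "am < exp s" "\<bar>\<phi>\<bar> < \<gamma>"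
  shows "exp (Complex s (pi/2 + \<phi>)) \<in> Usym am ap \<gamma>"
proof -
  have "Re (exp (Complex s (pi/2 + \<phi>))) = - exp s * sin \<phi>"
    "Im (exp (Complex s (pi/2 + \<phi>))) = exp s * cos \<phi>"
    by (simp_all add: Re_exp Im_exp cos_add sin_add)
  moreover have "exp s * (\<bar>sin \<phi>\<bar> * cos \<gamma>) < exp s * (cos \<phi> * sin \<gamma>)"
    using abs_sin_cos_less[OF assms(5,2)] by simp
  moreover have "cos \<phi> > 0"
    using assms by (intro cos_gt_zero_pi) auto
  ultimately show ?thesis
    using assms unfolding mem_Usym_iff[OF assms(1,2)]
    by (auto simp: abs_mult mult.assoc intro!: exI[of _ 0])
qed

text \<open>
A point of the upper cone with apex \<open>0\<close> has its argument within \<open>\<gamma> \<le> pi / 2\<close> of \<open>pi / 2\<close>, which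
keeps it inside the range of the principal logarithm.
\<close>
lemma Ln_near_imaginary_axis:
  assumes "0 < \<gamma>" "\<gamma> \<le> pi / 2" "\<bar>Re z\<bar> * cos \<gamma> < Im z * sin \<gamma>"
  obtains \<phi> where "\<bar>\<phi>\<bar> < \<gamma>" "Ln z = Complex (ln (norm z)) (pi/2 + \<phi>)"
proof -
  have "- \<i> * z \<in> cone \<gamma>"
    using assms by (simp add: mem_cone_iff)
  then obtain \<rho> \<phi> where w: "- \<i> * z = of_real \<rho> * exp (\<i> * of_real \<phi>)" "\<bar>\<phi>\<bar> < \<gamma>" "\<rho> > 0"
    unfolding cone_def by blast
  have "z = \<i> * (- \<i> * z)"
    by (simp flip: mult.assoc)
  also have "\<dots> = of_real \<rho> * (\<i> * exp (\<i> * of_real \<phi>))"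
    unfolding w(1) by (simp add: mult_ac)
  also have "\<dots> = exp (Complex (ln \<rho>) (pi/2 + \<phi>))"
    using w(3) by (simp add: complex_eq_iff Re_exp Im_exp cos_add sin_add)
  finally have z: "z = exp (Complex (ln \<rho>) (pi/2 + \<phi>))" .
  have "norm z = \<rho>"
    unfolding z using w(3) by simp
  moreover have "Ln z = Complex (ln \<rho>) (pi/2 + \<phi>)"
    unfolding z by (rule Ln_exp) (use w(2) assms(2) in \<open>auto simp: abs_less_iff\<close>)
  ultimately show ?thesis
    using that w(2) by simp
qed

section \<open>The sinh curve\<close>

lemma chiL_Complex: "chiL \<sigma> b \<omega> (Complex y t) = chiL \<sigma> b (\<omega> + t) (of_real y)"
proof -
  have "\<i> * of_real \<omega> + Complex y t = \<i> * of_real (\<omega> + t) + of_real y"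
    by (simp add: complex_eq_iff)
  then show ?thesis
    unfolding chiL_def by (rule arg_cong)
qed

lemma
  shows Re_chiL_of_real: "Re (chiL \<sigma> b \<omega> (of_real y)) = \<sigma> - b * sin \<omega> * cosh y"
    and Im_chiL_of_real: "Im (chiL \<sigma> b \<omega> (of_real y)) = b * cos \<omega> * sinh y"
  by (simp_all add: chiL_def sinh_def cosh_def Re_exp Im_exp algebra_simps)

lemma chiL_minus: "chiL \<sigma> b \<omega> (of_real (- y)) = cnj (chiL \<sigma> b \<omega> (of_real y))"
  by (simp only: complex_eq_iff complex_cnj Re_chiL_of_real Im_chiL_of_real cnj.sel) simp

text \<open>
With \<open>v = cosh y - 1 \<ge> 0\<close> and \<open>(sinh y)\<^sup>2 = v\<^sup>2 + 2 * v\<close>, the square of the norm is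
\<open>x\<^sub>0\<^sup>2 + (b * v)\<^sup>2 + 2 * b * v * (b * (cos \<omega>)\<^sup>2 - x\<^sub>0 * sin \<omega>)\<close>.  The last hypothesis makes the mixed
term nonnegative: when the curve bends to the left, \<open>b\<close> must be large enough for it to rise out of
the disc of radius \<open>x\<^sub>0\<close>.
\<close>
lemma norm_chiL_ge:
  assumes "b > 0" and x0: "\<sigma> - b * sin \<omega> = x\<^sub>0" and "x\<^sub>0 > 0" and "x\<^sub>0 * sin \<omega> \<le> b * (cos \<omega>)\<^sup>2"
  shows "x\<^sub>0 \<le> norm (chiL \<sigma> b \<omega> (of_real y))" (is "_ \<le> ?r")
    and "cosh y \<le> (1 / x\<^sub>0 + 1 / b) * norm (chiL \<sigma> b \<omega> (of_real y))"
proof -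
  define v where "v = cosh y - 1"
  have v: "v \<ge> 0"
    using cosh_real_ge_1[of y] by (simp add: v_def)
  have s: "(sinh y)\<^sup>2 = v\<^sup>2 + 2 * v"
    using hyperbolic_pythagoras[of y] by (simp add: v_def power2_eq_square algebra_simps)
  have expand: "(x\<^sub>0 - b * S * v)\<^sup>2 + (b * C)\<^sup>2 * (v\<^sup>2 + 2 * v)
      = x\<^sub>0\<^sup>2 + (b * v)\<^sup>2 * (S\<^sup>2 + C\<^sup>2) + 2 * b * v * (b * C\<^sup>2 - x\<^sub>0 * S)" for S C
    by (simp add: power2_eq_square algebra_simps)
  have "?r\<^sup>2 = (x\<^sub>0 - b * sin \<omega> * v)\<^sup>2 + (b * cos \<omega>)\<^sup>2 * (sinh y)\<^sup>2"
    unfolding cmod_power2 Re_chiL_of_real Im_chiL_of_real x0[symmetric]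
    by (simp add: v_def algebra_simps power_mult_distrib)
  also have "\<dots> = x\<^sub>0\<^sup>2 + (b * v)\<^sup>2 * ((sin \<omega>)\<^sup>2 + (cos \<omega>)\<^sup>2)
                 + 2 * b * v * (b * (cos \<omega>)\<^sup>2 - x\<^sub>0 * sin \<omega>)"
    unfolding s by (rule expand)
  finally have r: "?r\<^sup>2 = x\<^sub>0\<^sup>2 + (b * v)\<^sup>2 + 2 * b * v * (b * (cos \<omega>)\<^sup>2 - x\<^sub>0 * sin \<omega>)"
    by simp
  have nonneg: "2 * b * v * (b * (cos \<omega>)\<^sup>2 - x\<^sub>0 * sin \<omega>) \<ge> 0"
    using assms v by simp
  have sq: "x\<^sub>0\<^sup>2 \<le> ?r\<^sup>2" "(b * v)\<^sup>2 \<le> ?r\<^sup>2"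
    using r nonneg zero_le_power2[of x\<^sub>0] zero_le_power2[of "b * v"] by linarith+
  have le: "x\<^sub>0 \<le> ?r" "b * v \<le> ?r"
    by (rule power2_le_imp_le[OF sq(1) norm_ge_zero], rule power2_le_imp_le[OF sq(2) norm_ge_zero])
  then show "x\<^sub>0 \<le> ?r"
    by simp
  have "1 \<le> ?r / x\<^sub>0" "v \<le> ?r / b"
    using le assms by (simp_all add: field_simps)
  then show "cosh y \<le> (1 / x\<^sub>0 + 1 / b) * ?r"
    by (simp add: v_def algebra_simps)
qed

lemma cosh_minus_1_less_abs_sinh:
  fixes y :: real
  assumes "y \<noteq> 0"
  shows "cosh y - 1 < \<bar>sinh y\<bar>"
proof -
  have "cosh y - \<bar>sinh y\<bar> = exp (- \<bar>y\<bar>)"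
    using cosh_minus_sinh[of y] cosh_plus_sinh[of y] by (simp add: abs_if)
  moreover have "exp (- \<bar>y\<bar>) < 1"
    using assms by simp
  ultimately show ?thesis
    by linarith
qed

text \<open>
The cone with apex \<open>x\<^sub>0\<close> contains the curve apart from \<open>y = 0\<close>: the horizontal distance from the apex
is \<open>b * \<bar>sin \<omega>\<bar> * (cosh y - 1)\<close>, the vertical one is \<open>b * cos \<omega> * \<bar>sinh y\<bar>\<close>, where
\<open>cosh y - 1 < \<bar>sinh y\<bar>\<close>, and the slope \<open>\<bar>sin \<omega>\<bar> / cos \<omega>\<close> is admissible for the half-angle
\<open>\<gamma> > \<bar>\<omega>\<bar>\<close>.  For \<open>y = 0\<close> the curve is at the apex.
\<close>
lemma chiL_mem_Usym:
  assumes "\<bar>\<omega>\<bar> < \<gamma>" "\<gamma> \<le> pi / 2" and "b > 0"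
    and x0: "\<sigma> - b * sin \<omega> = x\<^sub>0" and "x\<^sub>0 > 0" "am < x\<^sub>0" "x\<^sub>0 < ap"
    and "x\<^sub>0 * sin \<omega> \<le> b * (cos \<omega>)\<^sup>2"
  shows "chiL \<sigma> b \<omega> (of_real y) \<in> Usym am ap \<gamma>" (is "?z \<in> _")
proof -
  have \<gamma>: "0 < \<gamma>" "cos \<gamma> \<ge> 0" and cos: "cos \<omega> > 0"
    using assms(1,2) by (auto intro!: cos_ge_zero cos_gt_zero_pi)
  have "am < norm ?z"
    using norm_chiL_ge(1)[OF assms(3) x0 assms(5,8)] \<open>am < x\<^sub>0\<close> by (rule less_le_trans[rotated])
  moreover have "\<bar>Re ?z\<bar> < ap \<or> \<bar>Re ?z - x\<^sub>0\<bar> * cos \<gamma> < \<bar>Im ?z\<bar> * sin \<gamma>"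
  proof (cases "y = 0")
    case True
    then show ?thesis
      using assms Re_chiL_of_real[of \<sigma> b \<omega> y] by simp
  next
    case False
    have "Re ?z - x\<^sub>0 = - (b * sin \<omega> * (cosh y - 1))"
      unfolding Re_chiL_of_real x0[symmetric] by (simp add: algebra_simps)
    then have "\<bar>Re ?z - x\<^sub>0\<bar> * cos \<gamma> = b * (cosh y - 1) * (\<bar>sin \<omega>\<bar> * cos \<gamma>)"
      using \<open>b > 0\<close> cosh_real_ge_1[of y] by (simp add: abs_mult)
    also have "\<dots> \<le> b * \<bar>sinh y\<bar> * (\<bar>sin \<omega>\<bar> * cos \<gamma>)"
      using \<open>b > 0\<close> \<gamma>(2) cosh_minus_1_less_abs_sinh[OF False]
      by (intro mult_right_mono mult_left_mono) auto
    also have "\<dots> < b * \<bar>sinh y\<bar> * (cos \<omega> * sin \<gamma>)"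
      using \<open>b > 0\<close> False abs_sin_cos_less[OF assms(1,2)] by (intro mult_strict_left_mono) auto
    also have "\<dots> = \<bar>Im ?z\<bar> * sin \<gamma>"
      using \<open>b > 0\<close> cos by (simp add: Im_chiL_of_real abs_mult)
    finally show ?thesis ..
  qed
  ultimately show ?thesis
    using assms(5,7) unfolding mem_Usym_iff[OF \<gamma>(1) assms(2)] by (metis abs_of_pos)
qed

text \<open>
The line at height \<open>t\<close> in the strip is mapped to the curve with parameter \<open>\<omega> + t\<close>, and the conditions
under which that curve stays in the domain are open in the parameter.
\<close>
lemma strip_subset_Usym:
  assumes "\<bar>\<omega>\<bar> < \<gamma>" "\<gamma> \<le> pi / 2" and "b > 0" and "0 \<le> am" "am < \<sigma> - b * sin \<omega>" "\<sigma> - b * sin \<omega> < ap"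
    and "(\<sigma> - b * sin \<omega>) * sin \<omega> < b * (cos \<omega>)\<^sup>2"
  shows "\<exists>d>0. chiL \<sigma> b \<omega> ` strip d \<subseteq> Usym am ap \<gamma>"
proof -
  let ?P = "\<lambda>\<theta>. \<bar>\<theta>\<bar> < \<gamma> \<and> am < \<sigma> - b * sin \<theta> \<and> \<sigma> - b * sin \<theta> < ap \<and>
              (\<sigma> - b * sin \<theta>) * sin \<theta> < b * (cos \<theta>)\<^sup>2"
  have "open {\<theta>. ?P \<theta>}"
    by (intro open_Collect_conj open_Collect_less continuous_intros)
  moreover have "\<omega> \<in> {\<theta>. ?P \<theta>}"
    using assms by simp
  ultimately obtain d where d: "d > 0" "\<And>\<theta>. \<bar>\<theta> - \<omega>\<bar> < d \<Longrightarrow> ?P \<theta>"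
    unfolding open_dist by (auto simp: dist_real_def)
  have "chiL \<sigma> b \<omega> y \<in> Usym am ap \<gamma>" if "y \<in> strip d" for y
  proof -
    have P: "?P (\<omega> + Im y)"
      using that by (intro d(2)) (auto simp: strip_def)
    have "chiL \<sigma> b (\<omega> + Im y) (of_real (Re y)) \<in> Usym am ap \<gamma>"
      by (rule chiL_mem_Usym[where x\<^sub>0 = "\<sigma> - b * sin (\<omega> + Im y)"]) (use P assms in auto)
    then show ?thesis
      using chiL_Complex[of \<sigma> b \<omega> "Re y" "Im y"] by simp
  qed
  with d(1) show ?thesis
    by blast
qed

lemma chiL_notin_nonpos_Reals:
  assumes "b > 0" "cos \<omega> > 0" "\<sigma> - b * sin \<omega> > 0"
  shows "chiL \<sigma> b \<omega> (of_real y) \<notin> \<real>\<^sub>\<le>\<^sub>0"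
proof (cases "y = 0")
  case True
  then show ?thesis
    using assms Re_chiL_of_real[of \<sigma> b \<omega> y] by (auto simp: complex_nonpos_Reals_iff)
next
  case False
  then show ?thesis
    using assms Im_chiL_of_real[of \<sigma> b \<omega> y] by (auto simp: complex_nonpos_Reals_iff)
qed

lemma norm_chiL_powr_le:
  fixes \<kappa> :: real
  assumes "cosh y \<le> \<kappa> * norm (chiL \<sigma> b \<omega> (of_real y))" "\<kappa> > 0" "\<delta> > 0"
  shows "norm (chiL \<sigma> b \<omega> (of_real y)) powr (- \<delta>) \<le> (2 * \<kappa>) powr \<delta> * exp (- \<delta> * \<bar>y\<bar>)"
proof -
  have "exp \<bar>y\<bar> \<le> 2 * cosh y"
    by (auto simp: cosh_def abs_if)
  then have le: "exp \<bar>y\<bar> / (2 * \<kappa>) \<le> norm (chiL \<sigma> b \<omega> (of_real y))"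
    using assms by (simp add: field_simps)
  have "norm (chiL \<sigma> b \<omega> (of_real y)) powr (- \<delta>) \<le> (exp \<bar>y\<bar> / (2 * \<kappa>)) powr (- \<delta>)"
    using assms le by (intro powr_mono2') auto
  also have "\<dots> = (2 * \<kappa>) powr \<delta> * exp (- \<delta> * \<bar>y\<bar>)"
    using assms by (simp add: powr_divide powr_minus exp_powr_real exp_minus field_simps)
  finally show ?thesis .
qed

text \<open>
The asymptotic direction of the curve makes the angle \<open>\<omega>\<close> with the imaginary axis, so the curve
finally enters every cone around that axis whose half-angle \<open>\<gamma>\<close> exceeds \<open>\<bar>\<omega>\<bar>\<close>, although it starts
on the real axis.
\<close>
lemma eventually_chiL_near_imaginary_axis:
  assumes "\<bar>\<omega>\<bar> < \<gamma>" "\<gamma> \<le> pi / 2" and "b > 0" and x0: "\<sigma> - b * sin \<omega> = x\<^sub>0" and "x\<^sub>0 > 0"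
  shows "\<forall>\<^sub>F y in at_top.
    \<bar>Re (chiL \<sigma> b \<omega> (of_real y))\<bar> * cos \<gamma> < Im (chiL \<sigma> b \<omega> (of_real y)) * sin \<gamma>"
proof -
  define \<epsilon> where "\<epsilon> = cos \<omega> * sin \<gamma> - \<bar>sin \<omega>\<bar> * cos \<gamma>"
  have \<epsilon>: "\<epsilon> > 0"
    using abs_sin_cos_less[OF assms(1,2)] by (simp add: \<epsilon>_def)
  have cos: "cos \<gamma> \<ge> 0"
    using assms(1,2) by (intro cos_ge_zero) auto
  have "filterlim (\<lambda>y. b * \<epsilon> * sinh y :: real) at_top at_top"
    using \<open>b > 0\<close> \<epsilon> by (intro filterlim_tendsto_pos_mult_at_top[OF tendsto_const] sinh_real_at_top) auto
  then have "\<forall>\<^sub>F y in at_top. x\<^sub>0 * cos \<gamma> < b * \<epsilon> * sinh y"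
    by (simp add: filterlim_at_top_dense)
  then show ?thesis
    using eventually_gt_at_top[of 0]
  proof eventually_elim
    case (elim y)
    have "Re (chiL \<sigma> b \<omega> (of_real y)) = x\<^sub>0 - b * sin \<omega> * (cosh y - 1)"
      unfolding Re_chiL_of_real x0[symmetric] by (simp add: algebra_simps)
    also have "\<bar>\<dots>\<bar> \<le> x\<^sub>0 + \<bar>b * sin \<omega> * (cosh y - 1)\<bar>"
      using \<open>x\<^sub>0 > 0\<close> by linarith
    also have "\<bar>b * sin \<omega> * (cosh y - 1)\<bar> = b * \<bar>sin \<omega>\<bar> * (cosh y - 1)"
      using \<open>b > 0\<close> cosh_real_ge_1[of y] by (simp add: abs_mult)
    also have "\<dots> \<le> b * \<bar>sin \<omega>\<bar> * sinh y"
      using \<open>b > 0\<close> cosh_minus_1_less_abs_sinh[of y] elim by (intro mult_left_mono) auto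
    finally have "\<bar>Re (chiL \<sigma> b \<omega> (of_real y))\<bar> * cos \<gamma> \<le> (x\<^sub>0 + b * \<bar>sin \<omega>\<bar> * sinh y) * cos \<gamma>"
      using cos by (intro mult_right_mono) auto
    also have "\<dots> < (b * cos \<omega> * sinh y) * sin \<gamma>"
      using elim by (simp add: \<epsilon>_def algebra_simps)
    finally show ?case
      by (simp add: Im_chiL_of_real)
  qed
qed

lemma has_vector_derivative_chiL:
  "((\<lambda>y. chiL \<sigma> b \<omega> (of_real y)) has_vector_derivative
      \<i> * of_real b * cosh (\<i> * of_real \<omega> + of_real y)) (at y within A)"
  unfolding chiL_def
  by (auto intro!: derivative_eq_intros has_vector_derivative_real_field)

lemma norm_cosh_le: "norm (cosh z) \<le> cosh (Re z)" for z :: complex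
  using norm_triangle_ineq[of "exp z" "exp (- z)"] by (simp add: cosh_def)

section \<open>The integrand and its primitive in the logarithmic coordinate\<close>

definition folded :: "(complex \<Rightarrow> complex) \<Rightarrow> nat \<Rightarrow> complex \<Rightarrow> complex" where
  "folded F n z = (F z + (-1) ^ n * F (- z)) * z powi (- int n - 1)"

lemma folded_minus: "folded F n (- z) = - folded F n z"
  by (cases "even n") (simp_all add: folded_def power_int_minus_left algebra_simps)

lemma holomorphic_on_folded:
  assumes "F holomorphic_on U" and sym: "\<And>z. z \<in> U \<Longrightarrow> - z \<in> U" and "0 \<notin> U"
  shows "folded F n holomorphic_on U"
proof -
  have "(\<lambda>z. F (- z)) holomorphic_on U"
    by (rule holomorphic_on_compose_gen[OF _ assms(1), unfolded o_def])
       (use sym in \<open>auto intro!: holomorphic_intros\<close>)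
  then have "(\<lambda>z. (F z + (-1) ^ n * F (- z)) * z powi (- int n - 1)) holomorphic_on U"
    using assms(1,3) by (intro holomorphic_intros) auto
  then show ?thesis
    by (simp add: folded_def[abs_def])
qed

lemma continuous_on_folded:
  assumes "continuous_on A F" and sym: "\<And>z. z \<in> A \<Longrightarrow> - z \<in> A" and "0 \<notin> A"
  shows "continuous_on A (folded F n)"
proof -
  have "continuous_on A (\<lambda>z. F (- z))"
    by (rule continuous_on_compose2[OF assms(1)]) (use sym in \<open>auto intro!: continuous_intros\<close>)
  then have "continuous_on A (\<lambda>z. (F z + (-1) ^ n * F (- z)) * z powi (- int n - 1))"
    using assms(1,3) by (intro continuous_intros) auto
  then show ?thesis
    by (simp add: folded_def[abs_def])
qed

lemma powi_mult_self: "z \<noteq> 0 \<Longrightarrow> z powi (- int n - 1) * z = z powi (- int n)" for z :: complex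
  using power_int_add_1[of z "- int n - 1"] by simp

text \<open>
Away from the disc of radius \<open>rm\<close>, the bound \<open>(1 + norm z) powr m\<close> is comparable to \<open>norm z powr m\<close>
for either sign of \<open>m\<close>.  The factor \<open>z\<close> on the left belongs to the logarithmic coordinate, where
\<open>dz = z dw\<close>.
\<close>
lemma norm_folded_le:
  assumes "Z_SINH3 u F m am ap \<gamma>" "am < rm" "rm < rp" "rp < ap" "0 < \<gamma>'" "\<gamma>' < \<gamma>"
  obtains K where "K \<ge> 0"
    "\<And>z. z \<in> Usym rm rp \<gamma>' \<Longrightarrow> norm (folded F n z * z) \<le> K * norm z powr (m - real n)"
proof -
  obtain C where C: "\<And>z. z \<in> Usym rm rp \<gamma>' \<Longrightarrow> norm (F z) \<le> C * (1 + norm z) powr m"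
    using assms(1-6) unfolding Z_SINH3_def by blast
  have "rm > 0" "\<gamma>' \<le> pi / 2"
    using assms unfolding Z_SINH3_def by linarith+
  have sym: "- z \<in> Usym rm rp \<gamma>'" if "z \<in> Usym rm rp \<gamma>'" for z
    using that uminus_mem_Usym_iff[OF assms(5) \<open>\<gamma>' \<le> pi / 2\<close>] by simp
  \<comment> \<open>The two summands of \<open>K\<^sub>0\<close> serve the cases \<open>m < 0\<close> and \<open>m \<ge> 0\<close>.\<close>
  define K\<^sub>0 where "K\<^sub>0 = 1 + (1 + 1 / rm) powr m"
  have K0: "(1 + r) powr m \<le> K\<^sub>0 * r powr m" if "r > rm" for r
  proof -
    have "r > 0"
      using that \<open>rm > 0\<close> by simp
    have "1 + r = (1 + 1 / r) * r"
      using \<open>r > 0\<close> by (simp add: field_simps)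
    then have "(1 + r) powr m = (1 + 1 / r) powr m * r powr m"
      using \<open>r > 0\<close> by (simp add: powr_mult)
    also have "(1 + 1 / r) powr m \<le> K\<^sub>0"
    proof (cases "m \<ge> 0")
      case True
      have "(1 + 1 / r) powr m \<le> (1 + 1 / rm) powr m"
        using True that \<open>r > 0\<close> \<open>rm > 0\<close> by (intro powr_mono2) (auto simp: field_simps)
      then show ?thesis
        by (simp add: K\<^sub>0_def)
    next
      case False
      have "(1 + 1 / r) powr m \<le> (1 + 1 / r) powr 0"
        using False \<open>r > 0\<close> by (intro powr_mono) auto
      also have "\<dots> = 1"
        using add_pos_pos[of 1 "1 / r"] \<open>r > 0\<close> by simp
      also have "1 \<le> K\<^sub>0"
        by (simp add: K\<^sub>0_def)
      finally show ?thesis .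
    qed
    finally show ?thesis
      using \<open>r > 0\<close> by (simp add: mult_right_mono)
  qed
  have "K\<^sub>0 > 0"
    unfolding K\<^sub>0_def by (simp add: add_pos_nonneg)
  show ?thesis
  proof (rule that[of "2 * \<bar>C\<bar> * K\<^sub>0"])
    show "2 * \<bar>C\<bar> * K\<^sub>0 \<ge> 0"
      using \<open>K\<^sub>0 > 0\<close> by simp
    fix z assume z: "z \<in> Usym rm rp \<gamma>'"
    have r: "norm z > rm"
      using z unfolding Usym_def by auto
    then have "z \<noteq> 0"
      using \<open>rm > 0\<close> by auto
    have F: "norm (F x) \<le> \<bar>C\<bar> * K\<^sub>0 * norm z powr m" if "x \<in> Usym rm rp \<gamma>'" "norm x = norm z" for x
    proof -
      have "norm (F x) \<le> C * (1 + norm z) powr m"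
        using C[OF that(1)] that(2) by simp
      also have "\<dots> \<le> \<bar>C\<bar> * (1 + norm z) powr m"
        by (intro mult_right_mono) auto
      also have "\<dots> \<le> \<bar>C\<bar> * (K\<^sub>0 * norm z powr m)"
        using K0[OF r] by (intro mult_left_mono) auto
      finally show ?thesis
        by (simp add: mult.assoc)
    qed
    have "norm (F z + (-1) ^ n * F (- z)) \<le> norm (F z) + norm (F (- z))"
      by (rule order.trans[OF norm_triangle_ineq]) (simp add: norm_mult norm_power)
    also have "\<dots> \<le> 2 * \<bar>C\<bar> * K\<^sub>0 * norm z powr m"
      using F[of z] F[of "- z"] z sym[OF z] by simp
    finally have "norm (F z + (-1) ^ n * F (- z)) * norm z powr (- real n)
        \<le> 2 * \<bar>C\<bar> * K\<^sub>0 * norm z powr m * norm z powr (- real n)"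
      by (intro mult_right_mono) auto
    moreover have "norm (folded F n z * z) = norm (F z + (-1) ^ n * F (- z)) * norm z powr (- real n)"
      using \<open>z \<noteq> 0\<close> by (simp add: folded_def mult.assoc powi_mult_self norm_mult norm_power_int
          norm_inverse norm_power powr_minus powr_realpow power_int_minus)
    ultimately show "norm (folded F n z * z) \<le> 2 * \<bar>C\<bar> * K\<^sub>0 * norm z powr (m - real n)"
      by (simp add: mult.assoc flip: powr_add)
  qed
qed

text \<open>
The coefficient \<open>H\<close> in \<open>G z dz = H w dw\<close> for \<open>G = folded F n\<close> and \<open>z = exp w\<close>.
\<close>
definition log_kernel :: "(complex \<Rightarrow> complex) \<Rightarrow> nat \<Rightarrow> complex \<Rightarrow> complex" where
  "log_kernel F n w = folded F n (exp w) * exp w"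

text \<open>
Under \<open>w \<mapsto> w + \<i> * pi\<close> both factors change sign.
\<close>
lemma log_kernel_periodic: "log_kernel F n (w + \<i> * of_real pi) = log_kernel F n w"
  by (simp add: log_kernel_def exp_add folded_minus)

text \<open>
A holomorphic function on a simply connected open set has a primitive.  The translate of the primitive
by the period \<open>\<i> * pi\<close> is again a primitive, so it differs by a constant \<open>c\<close>.
\<close>
lemma log_kernel_primitive:
  assumes U: "0 < \<gamma>" "\<gamma> \<le> pi / 2" "0 \<le> am" "am < 1" "1 \<le> ap"
    and F: "F holomorphic_on Usym am ap \<gamma>"
  obtains \<Phi> c where
    "\<And>w. exp w \<in> Usym am ap \<gamma> \<Longrightarrow> (\<Phi> has_field_derivative log_kernel F n w) (at w)"
    "\<And>w. exp w \<in> Usym am ap \<gamma> \<Longrightarrow> \<Phi> (w + \<i> * of_real pi) = \<Phi> w + c"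
proof -
  define D where "D = (exp -` Usym am ap \<gamma> :: complex set)"
  have "open D"
    unfolding D_def by (rule open_exp_vimage_Usym[OF U(1,2)])
  have sc: "simply_connected D"
    unfolding D_def by (intro contractible_imp_simply_connected contractible_exp_vimage_Usym U)
  have "folded F n holomorphic_on Usym am ap \<gamma>"
    using F by (rule holomorphic_on_folded) (use uminus_mem_Usym_iff[OF U(1,2)] mem_Usym_iff[OF U(1,2), of 0] U in auto)
  then have "(\<lambda>w. folded F n (exp w)) holomorphic_on D"
    by (rule holomorphic_on_compose_gen[OF holomorphic_on_exp, unfolded o_def]) (auto simp: D_def)
  then have "log_kernel F n holomorphic_on D"
    unfolding log_kernel_def[abs_def] by (intro holomorphic_intros)
  then obtain \<Phi> where \<Phi>: "\<And>w. w \<in> D \<Longrightarrow> (\<Phi> has_field_derivative log_kernel F n w) (at w)"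
    using sc unfolding simply_connected_eq_global_primitive[OF \<open>open D\<close>] by blast
  have shift: "w + \<i> * of_real pi \<in> D" if "w \<in> D" for w
    using that U by (simp add: D_def exp_add uminus_mem_Usym_iff)
  have "((\<lambda>w. \<Phi> (w + \<i> * of_real pi) - \<Phi> w) has_field_derivative 0) (at w)" if "w \<in> D" for w
  proof -
    have "((\<lambda>w. \<Phi> (w + \<i> * of_real pi)) has_field_derivative log_kernel F n w) (at w)"
      using \<Phi>[OF shift[OF that]] unfolding DERIV_shift log_kernel_periodic by simp
    from DERIV_diff[OF this \<Phi>[OF that]] show ?thesis
      by simp
  qed
  then have deriv: "\<forall>w\<in>D - {}. ((\<lambda>w. \<Phi> (w + \<i> * of_real pi) - \<Phi> w) has_field_derivative 0) (at w)"
    by blast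
  then have "continuous_on D (\<lambda>w. \<Phi> (w + \<i> * of_real pi) - \<Phi> w)"
    by (intro continuous_at_imp_continuous_on) (auto intro: DERIV_isCont)
  then obtain c where "\<And>w. w \<in> D \<Longrightarrow> \<Phi> (w + \<i> * of_real pi) - \<Phi> w = c"
    using DERIV_zero_connected_constant[OF simply_connected_imp_connected[OF sc] \<open>open D\<close>
        finite.emptyI _ deriv] by blast
  then show ?thesis
    using that[of \<Phi> c] \<Phi> by (auto simp: D_def diff_eq_eq add.commute)
qed

text \<open>
The two arguments are joined by a vertical segment of length at most \<open>2 * \<gamma> \<le> pi\<close>, along which
\<open>norm (exp w)\<close> is constant.  In the plane of \<open>z = exp w\<close> this bounds the integral over an arc that
crosses the imaginary axis.
\<close>
lemma norm_arc_difference_le: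
  assumes \<gamma>: "0 < \<gamma>" "\<gamma> \<le> pi / 2" and "0 < ap" "am < exp s" "\<bar>\<phi>\<bar> < \<gamma>"
    and \<Phi>: "\<And>w. exp w \<in> Usym am ap \<gamma> \<Longrightarrow> (\<Phi> has_field_derivative log_kernel F n w) (at w)"
    and K: "K \<ge> 0" "\<And>z. z \<in> Usym am ap \<gamma> \<Longrightarrow> norm (folded F n z * z) \<le> K * norm z powr \<alpha>"
  shows "norm (\<Phi> (Complex s (pi/2 + \<phi>)) - \<Phi> (Complex s (pi/2 - \<phi>))) \<le> K * exp s powr \<alpha> * pi"
proof -
  define S where "S = {w. Re w = s \<and> Im w < pi/2 + \<gamma> \<and> pi/2 - \<gamma> < Im w}"
  have "S = {w. Re w \<le> s} \<inter> {w. Re w \<ge> s} \<inter> ({w. Im w < pi/2 + \<gamma>} \<inter> {w. Im w > pi/2 - \<gamma>})"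
    by (auto simp: S_def)
  then have "convex S"
    by (simp add: convex_Int convex_halfspace_Im_lt convex_halfspace_Im_gt convex_halfspace_Re_le convex_halfspace_Re_ge)
  have U: "exp w \<in> Usym am ap \<gamma>" if "w \<in> S" for w
    using exp_near_imaginary_axis_mem_Usym[OF assms(1-4), of "Im w - pi/2"] that
    by (auto simp: S_def abs_less_iff)
  have "norm (\<Phi> (Complex s (pi/2 + \<phi>)) - \<Phi> (Complex s (pi/2 - \<phi>)))
      \<le> K * exp s powr \<alpha> * norm (Complex s (pi/2 + \<phi>) - Complex s (pi/2 - \<phi>))"
  proof (rule field_differentiable_bound[OF \<open>convex S\<close>])
    fix w assume w: "w \<in> S"
    show "(\<Phi> has_field_derivative log_kernel F n w) (at w within S)"
      using \<Phi>[OF U[OF w]] by (rule has_field_derivative_at_within)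
    show "norm (log_kernel F n w) \<le> K * exp s powr \<alpha>"
      using K(2)[OF U[OF w]] w by (simp add: log_kernel_def S_def)
  qed (use assms(5) in \<open>auto simp: S_def abs_less_iff\<close>)
  also have "norm (Complex s (pi/2 + \<phi>) - Complex s (pi/2 - \<phi>)) = 2 * \<bar>\<phi>\<bar>"
  proof -
    have "Complex s (pi/2 + \<phi>) - Complex s (pi/2 - \<phi>) = \<i> * of_real (2 * \<phi>)"
      by (simp add: complex_eq_iff)
    then show ?thesis
      by (simp add: norm_mult)
  qed
  also have "K * exp s powr \<alpha> * (2 * \<bar>\<phi>\<bar>) \<le> K * exp s powr \<alpha> * pi"
    using assms by (intro mult_left_mono) auto
  finally show ?thesis .
qed

text \<open>
The factor \<open>inverse z\<close> from the derivative of \<open>Ln\<close> cancels the factor \<open>z\<close> in \<open>log_kernel F n (Ln z)\<close>.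
\<close>
lemma has_vector_derivative_primitive_chiL:
  assumes \<Phi>: "(\<Phi> has_field_derivative log_kernel F n (Ln z)) (at (Ln z))"
    and z: "z = chiL \<sigma> b \<omega> (of_real y)" "z \<notin> \<real>\<^sub>\<le>\<^sub>0"
  shows "((\<lambda>y. \<Phi> (Ln (chiL \<sigma> b \<omega> (of_real y)))) has_vector_derivative
    folded F n z * (\<i> * of_real b * cosh (\<i> * of_real \<omega> + of_real y))) (at y within A)"
proof -
  have "z \<noteq> 0"
    using z(2) by auto
  have "((\<lambda>z. \<Phi> (Ln z)) has_field_derivative log_kernel F n (Ln z) * inverse z) (at z)"
    by (rule DERIV_chain2[OF \<Phi> has_field_derivative_Ln[OF z(2)]])
  also have "log_kernel F n (Ln z) * inverse z = folded F n z"
    using \<open>z \<noteq> 0\<close> by (simp add: log_kernel_def)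
  finally have "((\<lambda>z. \<Phi> (Ln z)) has_field_derivative folded F n z) (at (chiL \<sigma> b \<omega> (of_real y)))"
    unfolding z(1) .
  from field_vector_diff_chain_within[OF has_vector_derivative_chiL has_field_derivative_at_within[OF this]]
  show ?thesis
    unfolding o_def z(1) by (simp add: mult_ac)
qed

section \<open>The increment over a half period is the Fourier coefficient\<close>

lemma has_integral_vertical_segment:
  assumes "\<And>t. (\<Phi> has_field_derivative f (Complex s t)) (at (Complex s t))"
    and "\<And>w. Re w = s \<Longrightarrow> \<Phi> (w + \<i> * of_real pi) = \<Phi> w + c"
  shows "((\<lambda>t. f (Complex s t)) has_integral (c / \<i>)) {-pi/2..pi/2}"
proof -
  have "((\<lambda>t. \<Phi> (Complex s t)) has_vector_derivative (\<i> * f (Complex s t))) (at t within {-pi/2..pi/2})" for t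
  proof -
    have "((\<lambda>t. Complex s t) has_vector_derivative \<i>) (at t within {-pi/2..pi/2})"
      unfolding Complex_eq by (auto intro!: derivative_eq_intros)
    from field_vector_diff_chain_within[OF this has_field_derivative_at_within[OF assms(1)]]
    show ?thesis
      by (simp add: o_def)
  qed
  then have "((\<lambda>t. \<i> * f (Complex s t)) has_integral
      \<Phi> (Complex s (pi/2)) - \<Phi> (Complex s (-pi/2))) {-pi/2..pi/2}"
    by (intro fundamental_theorem_of_calculus) auto
  moreover have "Complex s (pi/2) = Complex s (-pi/2) + \<i> * of_real pi"
    by (simp add: complex_eq_iff)
  ultimately have "((\<lambda>t. \<i> * f (Complex s t)) has_integral c) {-pi/2..pi/2}"
    using assms(2)[of "Complex s (-pi/2)"] by simp
  from has_integral_mult_right[OF this, of "- \<i>"]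
  have "((\<lambda>t. - \<i> * (\<i> * f (Complex s t))) has_integral - \<i> * c) {-pi/2..pi/2}" .
  moreover have "- \<i> * (\<i> * z) = z" "- \<i> * c = c / \<i>" for z
    by (simp_all flip: mult.assoc)
  ultimately show ?thesis
    by (simp only:)
qed

lemma has_integral_cis_half_period:
  fixes k :: int
  assumes "even k"
  shows "((\<lambda>t. cis (of_int k * t)) has_integral (if k = 0 then pi else 0)) {-pi/2..pi/2}"
proof (cases "k = 0")
  case True
  then show ?thesis
    using has_integral_const_real[of "1::complex" "-pi/2" "pi/2"] by (simp add: scaleR_conv_of_real)
next
  case False
  obtain j where j: "k = 2 * j"
    using assms by (elim evenE)
  have "((\<lambda>t. cis (of_int k * t)) has_integral
      cis (of_int k * (pi/2)) / (\<i> * of_int k) - cis (of_int k * (-pi/2)) / (\<i> * of_int k)) {-pi/2..pi/2}"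
  proof (rule fundamental_theorem_of_calculus)
    fix t :: real
    have "((\<lambda>z. exp (\<i> * of_int k * z) / (\<i> * of_int k)) has_field_derivative
        exp (\<i> * of_int k * of_real t)) (at (of_real t))"
      using False by (auto intro!: derivative_eq_intros)
    from has_vector_derivative_real_field[OF this]
    show "((\<lambda>t. cis (of_int k * t) / (\<i> * of_int k)) has_vector_derivative cis (of_int k * t))
        (at t within {-pi/2..pi/2})"
      by (simp add: cis_conv_exp mult.assoc)
  qed simp
  moreover have "cis (of_int k * (pi/2)) = cis (of_int k * (-pi/2))"
    unfolding j by (auto simp: complex_eq_iff sin_zero_iff_int2)
  ultimately show ?thesis
    using False by simp
qed

text \<open>
In the integrand the term of index \<open>k\<close> has the coefficient \<open>u k * (1 + (-1) ^ (n + k))\<close>, which is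
\<open>0\<close> or \<open>2 * u k\<close>.  It survives only if \<open>k - n\<close> is even, and then \<open>cis ((k - n) * t)\<close> has period
\<open>pi\<close>, so its integral over the half circle vanishes unless \<open>k = n\<close>.  Absolute summability of \<open>u\<close>
justifies integration term by term.
\<close>
lemma has_integral_folded_ztransform:
  assumes "ell1 u"
  shows "((\<lambda>t. folded (ztransform u) n (cis t) * cis t) has_integral (2 * of_real pi * u (int n)))
           {-pi/2..pi/2}"
proof -
  \<comment> \<open>The term of index \<open>k\<close> of the integrand on the circle.\<close>
  define e where "e = (\<lambda>(k::int) t. if even (k - int n) then 2 * u k * cis (of_int (k - int n) * t) else 0)"
  have zt: "((\<lambda>k. u k * z powi k) has_sum ztransform u z) UNIV" if "norm z = 1" for z
    unfolding ztransform_def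
    by (rule has_sum_infsum, rule abs_summable_summable)
       (use assms that in \<open>simp add: ell1_def norm_mult norm_power_int\<close>)
  have e: "((\<lambda>k. e k t) has_sum folded (ztransform u) n (cis t) * cis t) UNIV" for t
  proof -
    have "((\<lambda>k. (u k * cis t powi k + (-1) ^ n * (u k * (- cis t) powi k)) * cis t powi (- int n)) has_sum
        (ztransform u (cis t) + (-1) ^ n * ztransform u (- cis t)) * cis t powi (- int n)) UNIV"
      by (rule has_sum_cmult_left[OF has_sum_add[OF zt has_sum_cmult_right[OF zt]]]) auto
    moreover have "(u k * cis t powi k + (-1) ^ n * (u k * (- cis t) powi k)) * cis t powi (- int n) = e k t" for k
    proof -
      have "cis t powi k * cis t powi (- int n) = cis (of_int (k - int n) * t)"
        by (simp add: cis_power_int cis_mult left_diff_distrib)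
      moreover have "(u k * z + (-1) ^ n * (u k * (if even k then z else - z))) * z'
          = (if even (k - int n) then 2 * u k * (z * z') else 0)" for z z' :: complex
        by (cases "even k"; cases "even n") (simp_all add: algebra_simps)
      ultimately show ?thesis
        unfolding e_def power_int_minus_left by simp
    qed
    ultimately show ?thesis
      by (simp add: folded_def mult.assoc powi_mult_self)
  qed
  have "uniform_limit {-pi/2..pi/2} (\<lambda>X t. \<Sum>k\<in>X. e k t) (\<lambda>t. \<Sum>\<^sub>\<infinity>k. e k t) (finite_subsets_at_top UNIV)"
  proof (rule Weierstrass_m_test_general)
    show "norm (e k t) \<le> 2 * norm (u k)" for k t
      by (simp add: e_def norm_mult)
    show "(\<lambda>k. 2 * norm (u k)) summable_on UNIV"
      using assms unfolding ell1_def by (rule summable_on_cmult_right)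
  qed
  then have unif: "uniform_limit {-pi/2..pi/2} (\<lambda>X t. \<Sum>k\<in>X. e k t)
      (\<lambda>t. folded (ztransform u) n (cis t) * cis t) (finite_subsets_at_top UNIV)"
    by (simp add: infsumI[OF e])
  have "continuous_on {-pi/2..pi/2} (e k)" for k
    by (cases "even (k - int n)") (simp_all add: e_def continuous_intros)
  then have cont: "continuous_on {-pi/2..pi/2} (\<lambda>t. \<Sum>k\<in>X. e k t)" for X
    by (intro continuous_on_sum)
  obtain I J where I: "\<And>X. ((\<lambda>t. \<Sum>k\<in>X. e k t) has_integral I X) {-pi/2..pi/2}"
    and J: "((\<lambda>t. folded (ztransform u) n (cis t) * cis t) has_integral J) {-pi/2..pi/2}"
    and lim: "(I \<longlongrightarrow> J) (finite_subsets_at_top UNIV)"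
    by (rule uniform_limit_integral[OF unif cont finite_subsets_at_top_neq_bot]) (rule that)
  have "((\<lambda>t. e k t) has_integral (if k = int n then 2 * of_real pi * u (int n) else 0)) {-pi/2..pi/2}" for k
  proof (cases "even (k - int n)")
    case True
    from has_integral_mult_right[OF has_integral_cis_half_period[OF True], of "2 * u k"] True
    show ?thesis
      by (cases "k = int n") (auto simp: e_def mult_ac)
  qed (auto simp: e_def)
  then have "((\<lambda>t. \<Sum>k\<in>X. e k t) has_integral (\<Sum>k\<in>X. if k = int n then 2 * of_real pi * u (int n) else 0)) {-pi/2..pi/2}"
    if "finite X" for X
    using that by (intro has_integral_sum)
  from has_integral_unique[OF I this]
  have "I X = 2 * of_real pi * u (int n)" if "finite X" "int n \<in> X" for X
    using that by (simp add: sum.delta)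
  then have "\<forall>\<^sub>F X in finite_subsets_at_top UNIV. I X = 2 * of_real pi * u (int n)"
    unfolding eventually_finite_subsets_at_top by (intro exI[of _ "{int n}"]) auto
  then have "(I \<longlongrightarrow> 2 * of_real pi * u (int n)) (finite_subsets_at_top UNIV)"
    by (rule tendsto_eventually)
  with lim have "J = 2 * of_real pi * u (int n)"
    by (rule tendsto_unique[OF finite_subsets_at_top_neq_bot])
  with J show ?thesis
    by (rule back_subst)
qed

text \<open>
For \<open>s < 0\<close> with \<open>exp s > am\<close>, the integral of the kernel over the segment on \<open>Re w = s\<close> is
\<open>c / \<i>\<close>.  The line \<open>Re w = 0\<close>, where \<open>F\<close> is the Z-transform, is only reached as a limit: if
\<open>ap = 1\<close>, the points \<open>1\<close> and \<open>-1\<close> of the circle lie on the boundary of the domain, and there the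
primitive need not exist.  Continuity of \<open>F\<close> on the closed annulus is what makes the limit valid.
\<close>
lemma log_kernel_period_eq_coefficient:
  assumes "ell1 u" and U: "0 < \<gamma>" "\<gamma> \<le> pi / 2" "0 \<le> am" "am < 1" "1 \<le> ap"
    and F: "continues_ztransform u F am ap \<gamma>"
    and \<Phi>: "\<And>w. exp w \<in> Usym am ap \<gamma> \<Longrightarrow> (\<Phi> has_field_derivative log_kernel F n w) (at w)"
    and c: "\<And>w. exp w \<in> Usym am ap \<gamma> \<Longrightarrow> \<Phi> (w + \<i> * of_real pi) = \<Phi> w + c"
  shows "c = 2 * of_real pi * \<i> * u (int n)"
proof -
  define s\<^sub>0 where "s\<^sub>0 = ln ((am + 1) / 2)"
  have s0: "am < exp s\<^sub>0" "s\<^sub>0 < 0"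
    using U unfolding s\<^sub>0_def by (auto simp: field_simps)
  define J where "J = (\<lambda>s. integral (cbox (-pi/2) (pi/2)) (\<lambda>t. log_kernel F n (Complex s t)))"
  have "continuous_on {z. am < norm z \<and> norm z \<le> 1} (folded F n)"
  proof (rule continuous_on_folded)
    have "continuous_on ((Usym am ap \<gamma> \<union> sphere 0 1) \<inter> cball 0 1) F"
      using F by (simp add: continues_ztransform_def)
    then show "continuous_on {z. am < norm z \<and> norm z \<le> 1} F"
      by (rule continuous_on_subset) (use closed_annulus_subset_domain[OF U(1,2,5)] in blast)
  qed (use U in auto)
  then have "continuous_on ({s\<^sub>0..0} \<times> cbox (-pi/2) (pi/2))
      (\<lambda>p. folded F n (exp (Complex (fst p) (snd p))))"
  proof (rule continuous_on_compose2)
    show "continuous_on ({s\<^sub>0..0} \<times> cbox (-pi/2) (pi/2)) (\<lambda>p. exp (Complex (fst p) (snd p)))"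
      unfolding Complex_eq by (intro continuous_intros)
    have "am < exp s" if "s\<^sub>0 \<le> s" for s
      using that by (intro less_le_trans[OF s0(1)]) auto
    then show "(\<lambda>p. exp (Complex (fst p) (snd p))) ` ({s\<^sub>0..0} \<times> cbox (-pi/2) (pi/2))
        \<subseteq> {z. am < norm z \<and> norm z \<le> 1}"
      by auto
  qed
  then have "continuous_on ({s\<^sub>0..0} \<times> cbox (-pi/2) (pi/2)) (\<lambda>(s, t). log_kernel F n (Complex s t))"
    unfolding log_kernel_def case_prod_unfold Complex_eq by (intro continuous_intros)
  then have "continuous_on {s\<^sub>0..0} J"
    unfolding J_def by (rule integral_continuous_on_param)
  then have cont: "continuous_on (closure {s\<^sub>0..<0}) J"
    using s0 by simp
  have J: "J s = c / \<i>" if "s \<in> {s\<^sub>0..<0}" for s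
  proof -
    have "am < exp s"
      using that by (intro less_le_trans[OF s0(1)]) auto
    moreover have "exp s < ap"
      using that by (intro less_le_trans[OF _ U(5)]) auto
    ultimately have "exp w \<in> Usym am ap \<gamma>" if "Re w = s" for w
      using that by (intro annulus_subset_Usym U) auto
    then have "((\<lambda>t. log_kernel F n (Complex s t)) has_integral (c / \<i>)) {-pi/2..pi/2}"
      by (intro has_integral_vertical_segment[of \<Phi>] \<Phi> c) auto
    then show ?thesis
      unfolding J_def by (simp add: integral_unique)
  qed
  have "J 0 = c / \<i>"
    using cont J by (rule continuous_constant_on_closure) (use s0 in auto)
  moreover have "log_kernel F n (Complex 0 t) = folded (ztransform u) n (cis t) * cis t" for t
    using F by (simp add: log_kernel_def folded_def continues_ztransform_def cis_conv_exp Complex_eq)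
  then have "J 0 = 2 * of_real pi * u (int n)"
    using has_integral_folded_ztransform[OF assms(1), of n] unfolding J_def by (simp add: integral_unique)
  ultimately have "c / \<i> = 2 * of_real pi * u (int n)"
    by simp
  moreover have "c = \<i> * (c / \<i>)"
    by simp
  ultimately show ?thesis
    by (simp only: mult_ac)
qed

section \<open>Integration along the sinh curve\<close>

lemma integrable_exp_minus_abs:
  assumes "a > 0"
  shows "integrable lborel (\<lambda>y::real. exp (- a * \<bar>y\<bar>))"
proof -
  have "(\<lambda>y. exp (- a * y)) absolutely_integrable_on {0..}"
    using integrable_on_exp_minus_to_infinity[OF assms, of 0]
    by (intro nonnegative_absolutely_integrable_1) auto
  then have "integrable lebesgue (\<lambda>y. indicator {0..} y *\<^sub>R exp (- a * y))"
    by (simp add: set_integrable_def)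
  then have half: "integrable lborel (\<lambda>y. indicator {0..} y *\<^sub>R exp (- a * y))"
    by (subst (asm) integrable_completion) auto
  have "integrable lborel (\<lambda>y. indicator {0..} (0 + - 1 * y) *\<^sub>R exp (- a * (0 + - 1 * y)))"
    by (rule lborel_integrable_real_affine[OF half]) simp
  from Bochner_Integration.integrable_add[OF half this] show ?thesis
    by (rule Bochner_Integration.integrable_bound) (auto simp: indicator_def)
qed

text \<open>
For the integral along the curve, only the difference of the primitive at \<open>y\<close> and \<open>- y\<close> is controlled,
not its limit at either end.
\<close>
lemma lborel_integral_eq_limit:
  fixes f :: "real \<Rightarrow> complex"
  assumes f: "integrable lborel f" and lim: "(\<lambda>k::nat. integral {- real k..real k} f) \<longlonglongrightarrow> L"
  shows "(LINT y|lborel. f y) = L"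
proof -
  have "(\<lambda>k::nat. LINT y|lborel. indicator {- real k..real k} y *\<^sub>R f y) \<longlonglongrightarrow> (LINT y|lborel. f y)"
  proof (rule integral_dominated_convergence)
    show "AE y in lborel. (\<lambda>k. indicator {- real k..real k} y *\<^sub>R f y) \<longlonglongrightarrow> f y"
    proof (intro AE_I2 tendsto_eventually)
      fix y :: real
      show "\<forall>\<^sub>F k in sequentially. indicator {- real k..real k} y *\<^sub>R f y = f y"
        using eventually_ge_at_top[of "nat \<lceil>\<bar>y\<bar>\<rceil>"]
        by eventually_elim (auto simp: indicator_def nat_le_iff ceiling_le_iff)
    qed
    show "AE y in lborel. norm (indicator {- real k..real k} y *\<^sub>R f y) \<le> norm (f y)" for k
      by (auto simp: indicator_def)
  qed (use f in auto)
  moreover have "(LINT y|lborel. indicator {- real k..real k} y *\<^sub>R f y) = integral {- real k..real k} f" for k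
  proof -
    have "set_integrable lborel {- real k..real k} f"
      unfolding set_integrable_def using f by (intro integrable_mult_indicator) auto
    from set_borel_integral_eq_integral(2)[OF this] show ?thesis
      by (simp add: set_lebesgue_integral_def)
  qed
  ultimately show ?thesis
    using lim by (simp add: LIMSEQ_unique)
qed

text \<open>
The growth condition holds only on domains smaller than \<open>Usym am ap \<gamma>\<close>.  The intermediate
parameters \<open>rm\<close>, \<open>rp\<close>, \<open>\<gamma>'\<close> are chosen such that the smaller domain still contains the curve and the
arcs between its ends and the imaginary axis.
\<close>
lemma sinh_contour_integral:
  assumes "ell1 u" and Z: "Z_SINH3 u F m am ap \<gamma>" and "real n > m"
    and "\<bar>\<omega>\<bar> < \<gamma>" "b > 0" and x0: "\<sigma> - b * sin \<omega> = x\<^sub>0" "am < x\<^sub>0" "x\<^sub>0 < 1"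
    and b: "x\<^sub>0 * sin \<omega> \<le> b * (cos \<omega>)\<^sup>2"
  shows "line_integrable (\<lambda>y. chiL \<sigma> b \<omega> (of_real y)) (folded F n)"
    and "line_integral (\<lambda>y. chiL \<sigma> b \<omega> (of_real y)) (folded F n) = 2 * of_real pi * \<i> * u (int n)"
proof -
  have U: "0 < \<gamma>" "\<gamma> \<le> pi / 2" "0 \<le> am" "am < 1" "1 \<le> ap"
    and F: "continues_ztransform u F am ap \<gamma>"
    using Z by (auto simp: Z_SINH3_def)
  have "x\<^sub>0 > 0" "x\<^sub>0 < ap" "cos \<omega> > 0"
    using assms(4) x0 U by (auto intro: cos_gt_zero_pi)
  define rm where "rm = (am + x\<^sub>0) / 2"
  define rp where "rp = (x\<^sub>0 + 1) / 2"
  define \<gamma>' where "\<gamma>' = (\<bar>\<omega>\<bar> + \<gamma>) / 2"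
  have rm: "0 < rm" "am < rm" "rm < x\<^sub>0" and rp: "x\<^sub>0 < rp" "rp < ap"
    and \<gamma>': "0 < \<gamma>'" "\<bar>\<omega>\<bar> < \<gamma>'" "\<gamma>' < \<gamma>" "\<gamma>' \<le> pi / 2"
    using x0 U \<open>x\<^sub>0 > 0\<close> assms(4) by (auto simp: rm_def rp_def \<gamma>'_def field_simps)
  define V where "V = Usym rm rp \<gamma>'"
  obtain K where K: "K \<ge> 0" "\<And>z. z \<in> V \<Longrightarrow> norm (folded F n z * z) \<le> K * norm z powr (m - real n)"
    using norm_folded_le[OF Z rm(2) less_trans[OF rm(3) rp(1)] rp(2) \<gamma>'(1,3), of n]
    unfolding V_def by blast
  have "F holomorphic_on Usym am ap \<gamma>"
    using F by (simp add: continues_ztransform_def)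
  then obtain \<Phi> c where \<Phi>: "\<And>w. exp w \<in> Usym am ap \<gamma> \<Longrightarrow> (\<Phi> has_field_derivative log_kernel F n w) (at w)"
    and c: "\<And>w. exp w \<in> Usym am ap \<gamma> \<Longrightarrow> \<Phi> (w + \<i> * of_real pi) = \<Phi> w + c"
    using log_kernel_primitive[OF U] by blast
  have period: "c = 2 * of_real pi * \<i> * u (int n)"
    using log_kernel_period_eq_coefficient[OF assms(1) U F \<Phi> c] .
  have VU: "z \<in> Usym am ap \<gamma>" if "z \<in> V" for z
    using that rm rp \<gamma>' Usym_mono[of am rm rp ap \<gamma>' \<gamma>] by (auto simp: V_def)

  define p where "p = (\<lambda>y. chiL \<sigma> b \<omega> (of_real y))"
  define p' where "p' = (\<lambda>y::real. \<i> * of_real b * cosh (\<i> * of_real \<omega> + of_real y))"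
  have deriv: "(p has_vector_derivative p' y) (at y within A)" for y A
    unfolding p_def p'_def by (rule has_vector_derivative_chiL)
  then have vd: "vector_derivative p (at y) = p' y" for y
    by (rule vector_derivative_at)
  have p_in: "p y \<in> V" for y
    unfolding p_def V_def
    by (rule chiL_mem_Usym[OF \<gamma>'(2,4) \<open>b > 0\<close> x0(1) \<open>x\<^sub>0 > 0\<close> rm(3) rp(1) b])
  have p_not_neg: "p y \<noteq> 0" "p y \<notin> \<real>\<^sub>\<le>\<^sub>0" for y
    using chiL_notin_nonpos_Reals[OF \<open>b > 0\<close> \<open>cos \<omega> > 0\<close>, of \<sigma> y] x0 \<open>x\<^sub>0 > 0\<close> by (auto simp: p_def)
  define \<kappa> where "\<kappa> = 1 / x\<^sub>0 + 1 / b"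
  have \<kappa>: "\<kappa> > 0" "cosh y \<le> \<kappa> * norm (p y)" for y
    using norm_chiL_ge(2)[OF \<open>b > 0\<close> x0(1) \<open>x\<^sub>0 > 0\<close> b] \<open>b > 0\<close> \<open>x\<^sub>0 > 0\<close>
    by (auto simp: \<kappa>_def p_def add_pos_pos)
  \<comment> \<open>Along the curve \<open>norm (p y)\<close> grows like \<open>cosh y\<close>, so a power of it decays exponentially.\<close>
  define \<delta> where "\<delta> = real n - m"
  have "\<delta> > 0"
    using assms(3) by (simp add: \<delta>_def)
  have decay: "norm (p y) powr (m - real n) \<le> (2 * \<kappa>) powr \<delta> * exp (- \<delta> * \<bar>y\<bar>)" for y
    using norm_chiL_powr_le[of y \<kappa> \<sigma> b \<omega> \<delta>] \<kappa> \<open>\<delta> > 0\<close> by (simp add: p_def \<delta>_def)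

  define f where "f = (\<lambda>y. folded F n (p y) * p' y)"
  define B where "B = K * (b * \<kappa>) * (2 * \<kappa>) powr \<delta>"
  have f_le: "norm (f y) \<le> B * exp (- \<delta> * \<bar>y\<bar>)" for y
  proof -
    have bound: "norm (folded F n (p y) * p y) \<le> K * ((2 * \<kappa>) powr \<delta> * exp (- \<delta> * \<bar>y\<bar>))"
      using K(2)[OF p_in] mult_left_mono[OF decay K(1)] by (rule order.trans)
    have "norm (p' y) \<le> b * cosh y"
      using norm_cosh_le[of "\<i> * of_real \<omega> + of_real y"] \<open>b > 0\<close> by (simp add: p'_def norm_mult)
    also have "\<dots> \<le> b * (\<kappa> * norm (p y))"
      using \<kappa> \<open>b > 0\<close> by simp
    finally have ratio: "norm (p' y) / norm (p y) \<le> b * \<kappa>"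
      using p_not_neg(1)[of y] by (simp add: field_simps)
    have "norm (f y) = norm (folded F n (p y) * p y) * (norm (p' y) / norm (p y))"
      using p_not_neg(1)[of y] by (simp add: f_def norm_mult)
    also have "\<dots> \<le> K * ((2 * \<kappa>) powr \<delta> * exp (- \<delta> * \<bar>y\<bar>)) * (b * \<kappa>)"
      using bound ratio K(1) by (intro mult_mono) auto
    finally show ?thesis
      by (simp add: B_def mult_ac)
  qed
  have "continuous_on UNIV f"
  proof -
    have "folded F n holomorphic_on Usym am ap \<gamma>"
      using \<open>F holomorphic_on _\<close>
      by (rule holomorphic_on_folded)
         (use uminus_mem_Usym_iff[OF U(1,2)] mem_Usym_iff[OF U(1,2), of 0] U in auto)
    then have "continuous_on (Usym am ap \<gamma>) (folded F n)"
      by (rule holomorphic_on_imp_continuous_on)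
    moreover have "continuous_on UNIV p"
      using deriv by (intro continuous_on_vector_derivative)
    ultimately have "continuous_on UNIV (\<lambda>y. folded F n (p y))"
      by (rule continuous_on_compose2) (use p_in VU in auto)
    then show ?thesis
      unfolding f_def p'_def cosh_def by (intro continuous_intros) auto
  qed
  then have meas: "f \<in> borel_measurable lborel"
    by (simp add: borel_measurable_continuous_onI)
  have int: "integrable lborel f"
  proof (rule Bochner_Integration.integrable_bound[OF _ meas])
    show "integrable lborel (\<lambda>y. B * exp (- \<delta> * \<bar>y\<bar>))"
      by (rule integrable_mult_right[OF integrable_exp_minus_abs[OF \<open>\<delta> > 0\<close>]])
    show "AE y in lborel. norm (f y) \<le> norm (B * exp (- \<delta> * \<bar>y\<bar>))"
      unfolding real_norm_def by (intro AE_I2 order.trans[OF f_le abs_ge_self])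
  qed
  then show "line_integrable (\<lambda>y. chiL \<sigma> b \<omega> (of_real y)) (folded F n)"
    using vd unfolding line_integrable_def f_def p_def by simp

  define \<Psi> where "\<Psi> = (\<lambda>y. \<Phi> (Ln (p y)))"
  have \<Psi>: "integral {- real k..real k} f = \<Psi> (real k) - \<Psi> (- real k)" for k
  proof (rule integral_unique, rule fundamental_theorem_of_calculus)
    fix y
    have "(\<Phi> has_field_derivative log_kernel F n (Ln (p y))) (at (Ln (p y)))"
      using p_in VU p_not_neg(1) by (intro \<Phi>) simp
    then show "(\<Psi> has_vector_derivative f y) (at y within {- real k..real k})"
      unfolding \<Psi>_def f_def p'_def p_def
      by (rule has_vector_derivative_primitive_chiL) (use p_not_neg(2) in \<open>simp_all add: p_def\<close>)
  qed simp
  have "\<forall>\<^sub>F y in at_top. norm (\<Psi> y - \<Psi> (- y) - c) \<le> K * ((2 * \<kappa>) powr \<delta> * exp (- \<delta> * \<bar>y\<bar>)) * pi"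
    using eventually_chiL_near_imaginary_axis[OF \<gamma>'(2,4) \<open>b > 0\<close> x0(1) \<open>x\<^sub>0 > 0\<close>]
  proof eventually_elim
    case (elim y)
    define s where "s = ln (norm (p y))"
    have s: "exp s = norm (p y)"
      using p_not_neg(1) by (simp add: s_def)
    obtain \<phi> where \<phi>: "\<bar>\<phi>\<bar> < \<gamma>'" "Ln (p y) = Complex s (pi/2 + \<phi>)"
      using Ln_near_imaginary_axis[OF \<gamma>'(1,4) elim] unfolding s_def p_def by blast
    \<comment> \<open>Conjugation and the shift by \<open>\<i> * pi\<close> together reflect the end point in \<open>Im w = pi / 2\<close>.\<close>
    have "Ln (p (- y)) = cnj (Ln (p y))"
      using cnj_Ln[OF p_not_neg(2)] unfolding p_def chiL_minus by simp
    also have "\<dots> + \<i> * of_real pi = Complex s (pi/2 - \<phi>)"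
      unfolding \<phi>(2) by (simp add: complex_eq_iff)
    finally have "\<Phi> (Complex s (pi/2 - \<phi>)) = \<Psi> (- y) + c"
      using c[of "Ln (p (- y))"] VU p_in p_not_neg(1) by (simp add: \<Psi>_def)
    then have "norm (\<Psi> y - \<Psi> (- y) - c) = norm (\<Phi> (Complex s (pi/2 + \<phi>)) - \<Phi> (Complex s (pi/2 - \<phi>)))"
      unfolding \<Psi>_def \<phi>(2) by (simp add: diff_diff_eq)
    also have "\<dots> \<le> K * exp s powr (m - real n) * pi"
    proof (rule norm_arc_difference_le[OF \<gamma>'(1,4) _ _ \<phi>(1)])
      show "0 < rp"
        using rp(1) \<open>x\<^sub>0 > 0\<close> by simp
      show "rm < exp s"
        using p_in[of y] by (simp add: s V_def Usym_def)
    qed (use \<Phi> VU K in \<open>auto simp: V_def\<close>)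
    also have "\<dots> \<le> K * ((2 * \<kappa>) powr \<delta> * exp (- \<delta> * \<bar>y\<bar>)) * pi"
      unfolding s using decay K(1) by (intro mult_right_mono mult_left_mono) auto
    finally show ?case .
  qed
  then have "((\<lambda>y. \<Psi> y - \<Psi> (- y) - c) \<longlongrightarrow> 0) at_top"
  proof (rule Lim_null_comparison)
    show "((\<lambda>y. K * ((2 * \<kappa>) powr \<delta> * exp (- \<delta> * \<bar>y\<bar>)) * pi) \<longlongrightarrow> 0) at_top"
      using \<open>\<delta> > 0\<close> by real_asymp
  qed
  then have "((\<lambda>y. \<Psi> y - \<Psi> (- y)) \<longlongrightarrow> c) at_top"
    by (simp add: LIM_zero_iff)
  then have "(\<lambda>k. integral {- real k..real k} f) \<longlonglongrightarrow> c"
    unfolding \<Psi> by (rule filterlim_compose[OF _ filterlim_real_sequentially])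
  then have "(LINT y|lborel. f y) = 2 * of_real pi * \<i> * u (int n)"
    using lborel_integral_eq_limit[OF int] period by simp
  then show "line_integral (\<lambda>y. chiL \<sigma> b \<omega> (of_real y)) (folded F n) = 2 * of_real pi * \<i> * u (int n)"
    using vd unfolding line_integral_def f_def p_def by simp
qed

theorem theorem4p5:
  fixes u :: "int \<Rightarrow> complex" and F :: "complex \<Rightarrow> complex"
    and m am ap \<gamma> :: real and n :: nat
  assumes "ell1 u"
    and "Z_SINH3 u F m am ap \<gamma>"
    and "real n > m"
  shows "\<forall>\<omega>\<in>{-\<gamma>/2<..<\<gamma>/2}. \<exists>b>0. \<exists>\<sigma>\<in>{am + b * sin \<omega><..<ap + b * sin \<omega>}.
      line_integrable (\<lambda>y. chiL \<sigma> b \<omega> (of_real y))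
        (\<lambda>z. (F z + (-1) ^ n * F (- z)) * z powi (- int n - 1)) \<and>
      u (int n) = 1 / (2 * of_real pi * \<i>) *
        line_integral (\<lambda>y. chiL \<sigma> b \<omega> (of_real y))
          (\<lambda>z. (F z + (-1) ^ n * F (- z)) * z powi (- int n - 1)) \<and>
      (\<exists>d>0. chiL \<sigma> b \<omega> ` strip d \<subseteq> Usym am ap \<gamma>)"
proof
  fix \<omega> assume "\<omega> \<in> {-\<gamma>/2<..<\<gamma>/2}"
  then have \<omega>: "\<bar>\<omega>\<bar> < \<gamma>"
    by (auto simp: abs_less_iff)
  have U: "0 < \<gamma>" "\<gamma> \<le> pi / 2" "0 \<le> am" "am < 1" "1 \<le> ap"
    using assms(2) by (auto simp: Z_SINH3_def)
  have cos: "cos \<omega> > 0"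
    using \<omega> U by (intro cos_gt_zero_pi) auto
  \<comment> \<open>The crossing point with the real axis lies inside the unit circle, hence also to the left of \<open>ap\<close>.\<close>
  define x\<^sub>0 where "x\<^sub>0 = (am + 1) / 2"
  have x0: "am < x\<^sub>0" "x\<^sub>0 < 1" "0 < x\<^sub>0"
    using U by (auto simp: x\<^sub>0_def)
  \<comment> \<open>\<open>b * (cos \<omega>)\<^sup>2 = 1\<close> exceeds \<open>x\<^sub>0 * sin \<omega>\<close>, as the curve requires in order to avoid the disc.\<close>
  define b where "b = 1 / (cos \<omega>)\<^sup>2"
  define \<sigma> where "\<sigma> = x\<^sub>0 + b * sin \<omega>"
  have b: "b > 0" "b * (cos \<omega>)\<^sup>2 = 1"
    using cos by (auto simp: b_def)
  have "x\<^sub>0 * sin \<omega> \<le> x\<^sub>0"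
    using x0(3) by simp
  then have less: "x\<^sub>0 * sin \<omega> < b * (cos \<omega>)\<^sup>2"
    using x0(2) b(2) by simp
  have "\<exists>d>0. chiL \<sigma> b \<omega> ` strip d \<subseteq> Usym am ap \<gamma>"
    by (rule strip_subset_Usym[OF \<omega> U(2) b(1) U(3)]) (use x0 U less in \<open>auto simp: \<sigma>_def\<close>)
  moreover have "\<sigma> \<in> {am + b * sin \<omega><..<ap + b * sin \<omega>}"
    using x0 U by (auto simp: \<sigma>_def)
  moreover have "\<sigma> - b * sin \<omega> = x\<^sub>0"
    by (simp add: \<sigma>_def)
  note contour = sinh_contour_integral[OF assms \<omega> b(1) this x0(1,2) less_imp_le[OF less]]
  have "u (int n) = 1 / (2 * of_real pi * \<i>) * line_integral (\<lambda>y. chiL \<sigma> b \<omega> (of_real y)) (folded F n)"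
    unfolding contour(2) by simp
  ultimately show "\<exists>b>0. \<exists>\<sigma>\<in>{am + b * sin \<omega><..<ap + b * sin \<omega>}.
      line_integrable (\<lambda>y. chiL \<sigma> b \<omega> (of_real y))
        (\<lambda>z. (F z + (-1) ^ n * F (- z)) * z powi (- int n - 1)) \<and>
      u (int n) = 1 / (2 * of_real pi * \<i>) *
        line_integral (\<lambda>y. chiL \<sigma> b \<omega> (of_real y))
          (\<lambda>z. (F z + (-1) ^ n * F (- z)) * z powi (- int n - 1)) \<and>
      (\<exists>d>0. chiL \<sigma> b \<omega> ` strip d \<subseteq> Usym am ap \<gamma>)"
    using b(1) contour(1) unfolding folded_def[abs_def] by blast
qed

end
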